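(* Let $D=\{0,1\}$ and $n\ge 1$. Every fan $\phi:D^n\to\mathbb{R}$ (upper fan or lower fan) is expressible by the set $\Gamma_{\mathsf{sub},2}$ of finite-valued submodular cost functions on $D$ of arity at most $2$, using at most $1+\lfloor m/2\rfloor$ extra variables, where $m$ is the degree of the polynomial representation of $\phi$. That is, there exist $j\le 1+\lfloor m/2\rfloor$, a function $\phi'(x_1,\dots,x_n,y_1,\dots,y_j)$ which is a nonnegative linear combination of functions from $\Gamma_{\mathsf{sub},2}$ (each applied to some of the variables $x_1,\dots,x_n,y_1,\dots,y_j$), and a constant $\kappa\in\mathbb{R}$, such that $\phi(x_1,\dots,x_n)=\min_{y_1,\dots,y_j\in D}\phi'(x_1,\dots,x_n,y_1,\dots,y_j)+\kappa$ for all $x\in D^n$.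
   Context: A cost function of arity $n$ on a set $D$ is a map $D^n\to\mathbb{R}\cup\{\infty\}$; it is finite-valued if it takes values in $\mathbb{R}$. On $D=\{0,1\}$, $D^n$ is ordered coordinatewise (a lattice with meet = coordinatewise $\min$, join = coordinatewise $\max$). A cost function $\phi$ on $D$ is submodular if $\phi(\min(u,v))+\phi(\max(u,v))\le\phi(u)+\phi(v)$ for all $u,v\in D^n$. For a set $\Gamma$ of cost functions, $\phi$ is expressible by $\Gamma$ if $\phi(x)=\min_{y_1,\dots,y_j}\phi'(x,y_1,\dots,y_j)+\kappa$ for some constant $\kappa$ and some $\phi'$ that is a finite sum $\alpha_1\phi_1+\dots+\alpha_r\phi_r$ with $\alpha_i\ge0$ and $\phi_i\in\Gamma$ applied to tuples of the variables; the $y_i$ are called extra variables. Fans: if $F\subseteq D^n$ is a set of pairwise incomparable elements such that every pair of distinct elements of $F$ has the same join $\bigvee F$ (the condition is vacuous if $|F|\le1$; $\bigvee\emptyset$ is the bottom element), the upper fan $\phi_F$ is defined by $\phi_F(x)=-2$ if $x\ge\bigvee F$, $\phi_F(x)=-1$ if $x\not\ge\bigvee F$ but $x\ge a$ for some $a\in F$, and $\phi_F(x)=0$ otherwise. Dually, if $G$ is a set of pairwise incomparable elements every pair of distinct elements of which has the same meet $\bigwedge G$, the lower fan $\phi_G$ is $-2$ if $x\le\bigwedge G$, $-1$ if $x\not\le\bigwedge G$ but $x\le a$ for some $a\in G$, and $0$ otherwise. A fan is an upper or lower fan. Every function $f:\{0,1\}^n\to\mathbb{R}$ has a unique polynomial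 representation $f(x)=\sum_{I\subseteq\{1,\dots,n\}}a_I\prod_{i\in I}x_i$; its degree is the maximum $|I|$ with $a_I\neq0$. *)

theory Defs
  imports Complex_Main "HOL-Library.Extended_Real"
begin

text \<open>The domain \<open>D = {0,1}\<close> is \<^typ>\<open>bool\<close> with \<open>False < True\<close>; elements of \<open>D\<^sup>n\<close> are
  lists of length \<open>n\<close>. Coordinates are numbered from 0.\<close>

definition tuples :: "nat \<Rightarrow> bool list set" where
  "tuples n = {x. length x = n}"

definition tuple_le :: "bool list \<Rightarrow> bool list \<Rightarrow> bool" where
  "tuple_le u v \<longleftrightarrow> list_all2 (\<le>) u v"

definition meet :: "bool list \<Rightarrow> bool list \<Rightarrow> bool list" where
  "meet u v = map2 min u v"

definition join :: "bool list \<Rightarrow> bool list \<Rightarrow> bool list" where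
  "join u v = map2 max u v"

definition big_meet :: "nat \<Rightarrow> bool list set \<Rightarrow> bool list" where
  "big_meet n F = map (\<lambda>i. INF a\<in>F. a ! i) [0..<n]"

definition big_join :: "nat \<Rightarrow> bool list set \<Rightarrow> bool list" where
  "big_join n F = map (\<lambda>i. SUP a\<in>F. a ! i) [0..<n]"


text \<open>A cost function is paired with its arity \<open>k\<close>; only its values on \<^term>\<open>tuples k\<close> are
  meaningful. Values lie in \<open>\<real> \<union> {\<infinity>}\<close>, i.e. \<open>-\<infinity>\<close> is never intended.\<close>

type_synonym cost_function = "nat \<times> (bool list \<Rightarrow> ereal)"

definition finite_valued :: "nat \<Rightarrow> (bool list \<Rightarrow> ereal) \<Rightarrow> bool" where
  "finite_valued k f \<longleftrightarrow> (\<forall>u\<in>tuples k. f u \<in> range ereal)"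

definition submodular :: "nat \<Rightarrow> (bool list \<Rightarrow> ereal) \<Rightarrow> bool" where
  "submodular k f \<longleftrightarrow>
     (\<forall>u\<in>tuples k. \<forall>v\<in>tuples k. f (meet u v) + f (join u v) \<le> f u + f v)"

definition Gamma_sub2 :: "cost_function set" where
  "Gamma_sub2 = {(k, f). k \<le> 2 \<and> finite_valued k f \<and> submodular k f}"

text \<open>A summand \<open>(\<alpha>, (k, f), s)\<close> stands for \<open>\<alpha> f(z\<^sub>s\<^sub>0, \<dots>, z\<^sub>s\<^sub>k\<^sub>-\<^sub>1)\<close>: the cost function \<open>f\<close> applied
  to the tuple of variables whose indices are listed in \<open>s\<close> (repetitions allowed).\<close>

definition nonneg_combination ::
    "cost_function set \<Rightarrow> nat \<Rightarrow> (bool list \<Rightarrow> ereal) \<Rightarrow> bool" where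
  "nonneg_combination \<Gamma> N \<psi> \<longleftrightarrow>
     (\<exists>ts :: (real \<times> cost_function \<times> nat list) list.
        (\<forall>(\<alpha>, (k, f), s) \<in> set ts.
           \<alpha> \<ge> 0 \<and> (k, f) \<in> \<Gamma> \<and> length s = k \<and> set s \<subseteq> {..<N}) \<and>
        (\<forall>z\<in>tuples N. \<psi> z = (\<Sum>(\<alpha>, (k, f), s)\<leftarrow>ts. ereal \<alpha> * f (map (\<lambda>i. z ! i) s))))"

text \<open>\<open>\<phi>\<close> of arity \<open>n\<close> is expressible by \<open>\<Gamma>\<close> using exactly \<open>j\<close> extra variables; these have the
  indices \<open>n, \<dots>, n + j - 1\<close>.\<close>

definition expressible_with ::
    "cost_function set \<Rightarrow> nat \<Rightarrow> nat \<Rightarrow> (bool list \<Rightarrow> ereal) \<Rightarrow> bool" where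
  "expressible_with \<Gamma> j n \<phi> \<longleftrightarrow>
     (\<exists>\<phi>' (\<kappa>::real). nonneg_combination \<Gamma> (n + j) \<phi>' \<and>
        (\<forall>x\<in>tuples n. \<phi> x = (MIN y\<in>tuples j. \<phi>' (x @ y)) + ereal \<kappa>))"


definition upper_fan_set :: "nat \<Rightarrow> bool list set \<Rightarrow> bool" where
  "upper_fan_set n F \<longleftrightarrow> F \<subseteq> tuples n \<and>
     (\<forall>a\<in>F. \<forall>b\<in>F. a \<noteq> b \<longrightarrow>
        \<not> tuple_le a b \<and> \<not> tuple_le b a \<and> join a b = big_join n F)"

definition upper_fan :: "nat \<Rightarrow> bool list set \<Rightarrow> bool list \<Rightarrow> real" where
  "upper_fan n F x =
     (if tuple_le (big_join n F) x then -2
      else if \<exists>a\<in>F. tuple_le a x then -1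
      else 0)"

definition lower_fan_set :: "nat \<Rightarrow> bool list set \<Rightarrow> bool" where
  "lower_fan_set n G \<longleftrightarrow> G \<subseteq> tuples n \<and>
     (\<forall>a\<in>G. \<forall>b\<in>G. a \<noteq> b \<longrightarrow>
        \<not> tuple_le a b \<and> \<not> tuple_le b a \<and> meet a b = big_meet n G)"

definition lower_fan :: "nat \<Rightarrow> bool list set \<Rightarrow> bool list \<Rightarrow> real" where
  "lower_fan n G x =
     (if tuple_le x (big_meet n G) then -2
      else if \<exists>a\<in>G. tuple_le x a then -1
      else 0)"

definition is_fan :: "nat \<Rightarrow> (bool list \<Rightarrow> real) \<Rightarrow> bool" where
  "is_fan n \<phi> \<longleftrightarrow>
     (\<exists>F. upper_fan_set n F \<and> (\<forall>x\<in>tuples n. \<phi> x = upper_fan n F x)) \<or>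
     (\<exists>G. lower_fan_set n G \<and> (\<forall>x\<in>tuples n. \<phi> x = lower_fan n G x))"


text \<open>Requiring \<open>a\<close> to vanish outside the subsets of the index set makes the coefficient family
  of the multilinear representation unique.\<close>

definition poly_rep :: "nat \<Rightarrow> (bool list \<Rightarrow> real) \<Rightarrow> (nat set \<Rightarrow> real) \<Rightarrow> bool" where
  "poly_rep n f a \<longleftrightarrow>
     (\<forall>I. \<not> I \<subseteq> {..<n} \<longrightarrow> a I = 0) \<and>
     (\<forall>x\<in>tuples n. f x = (\<Sum>I\<in>Pow {..<n}. a I * (\<Prod>i\<in>I. of_bool (x ! i))))"

definition poly_coeffs :: "nat \<Rightarrow> (bool list \<Rightarrow> real) \<Rightarrow> nat set \<Rightarrow> real" where
  "poly_coeffs n f = (THE a. poly_rep n f a)"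

text \<open>The zero function gets degree 0.\<close>

definition poly_degree :: "nat \<Rightarrow> (bool list \<Rightarrow> real) \<Rightarrow> nat" where
  "poly_degree n f = Max (insert 0 (card ` {I. I \<subseteq> {..<n} \<and> poly_coeffs n f I \<noteq> 0}))"

lemma poly_rep_iff:
  "poly_rep n f a \<longleftrightarrow>
     (\<forall>I. \<not> I \<subseteq> {..<n} \<longrightarrow> a I = 0) \<and>
     (\<forall>J\<subseteq>{..<n}. f (map (\<lambda>i. i \<in> J) [0..<n]) = sum a (Pow J))"
proof -
  have eval: "(\<Sum>I\<in>Pow {..<n}. a I * (\<Prod>i\<in>I. of_bool (map (\<lambda>i. i \<in> J) [0..<n] ! i))) = sum a (Pow J)"
    if J: "J \<subseteq> {..<n}" for J
  proof -
    have "(\<Prod>i\<in>I. of_bool (map (\<lambda>i. i \<in> J) [0..<n] ! i)) = (of_bool (I \<subseteq> J) :: real)"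
      if I: "I \<subseteq> {..<n}" for I
    proof -
      have fin: "finite I" using I finite_subset by blast
      have "(\<Prod>i\<in>I. of_bool (map (\<lambda>i. i \<in> J) [0..<n] ! i)) = (\<Prod>i\<in>I. of_bool (i \<in> J) :: real)"
        using I by (intro prod.cong) auto
      also have "\<dots> = of_bool (I \<subseteq> J)"
        using fin by (induction I rule: finite_induct) auto
      finally show ?thesis .
    qed
    then have "(\<Sum>I\<in>Pow {..<n}. a I * (\<Prod>i\<in>I. of_bool (map (\<lambda>i. i \<in> J) [0..<n] ! i)))
        = (\<Sum>I\<in>Pow {..<n}. a I * of_bool (I \<subseteq> J))"
      by (intro sum.cong) auto
    also have "\<dots> = sum a (Pow J)"
      using J by (intro sum.mono_neutral_cong_right) auto
    finally show ?thesis .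
  qed
  have tuples: "tuples n = (\<lambda>J. map (\<lambda>i. i \<in> J) [0..<n]) ` Pow {..<n}"
  proof (intro equalityI subsetI)
    fix x
    assume "x \<in> tuples n"
    then have "x = map (\<lambda>i. i \<in> {i. i < n \<and> x ! i}) [0..<n]"
      by (auto simp: tuples_def intro!: nth_equalityI)
    then show "x \<in> (\<lambda>J. map (\<lambda>i. i \<in> J) [0..<n]) ` Pow {..<n}"
      by (rule image_eqI) auto
  qed (auto simp: tuples_def)
  show ?thesis
    unfolding poly_rep_def tuples ball_simps using eval by auto
qed

lemma ex1_poly_rep: "\<exists>!a. poly_rep n f a"
proof (rule ex_ex1I)
  define g where "g J = f (map (\<lambda>i. i \<in> J) [0..<n])" for J
  define h where "h S = (\<Sum>T\<in>Pow S. (-1) ^ card T * g T)" for S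
  have gh: "g S = (\<Sum>T\<in>Pow S. (-1) ^ card T * h T)" if "finite S" for S
    by (rule inclusion_exclusion_symmetric[OF h_def that])
  have g: "g J = (\<Sum>I\<in>Pow J. if I \<subseteq> {..<n} then (-1) ^ card I * h I else 0)"
    if "J \<subseteq> {..<n}" for J
  proof -
    have "g J = (\<Sum>I\<in>Pow J. (-1) ^ card I * h I)"
      using finite_subset[OF that] gh by simp
    also have "\<dots> = (\<Sum>I\<in>Pow J. if I \<subseteq> {..<n} then (-1) ^ card I * h I else 0)"
    proof (rule sum.cong)
      fix I assume "I \<in> Pow J"
      then have "I \<subseteq> {..<n}" using that by blast
      then show "(-1) ^ card I * h I = (if I \<subseteq> {..<n} then (-1) ^ card I * h I else 0)" by simp
    qed simp
    finally show ?thesis .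
  qed
  have "poly_rep n f (\<lambda>I. if I \<subseteq> {..<n} then (-1) ^ card I * h I else 0)"
    unfolding poly_rep_iff g_def [symmetric] using g by simp
  then show "\<exists>a. poly_rep n f a" by blast
next
  fix a b
  assume a: "poly_rep n f a" and b: "poly_rep n f b"
  have eq: "a J = b J" if "finite J" "J \<subseteq> {..<n}" for J
    using that
  proof (induction J rule: finite_psubset_induct)
    case (psubset J)
    have split: "Pow J = insert J {I. I \<subset> J}" by auto
    have fin: "finite {I. I \<subset> J}"
      by (rule finite_subset[of _ "Pow J"]) (use psubset.hyps in auto)
    have "sum a (Pow J) = sum b (Pow J)"
      using a b psubset.prems unfolding poly_rep_iff by simp
    moreover have "sum a {I. I \<subset> J} = sum b {I. I \<subset> J}"
      using psubset by (intro sum.cong) auto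
    ultimately show ?case
      using fin by (simp add: split)
  qed
  show "a = b"
  proof
    fix I
    show "a I = b I"
    proof (cases "I \<subseteq> {..<n}")
      case True
      then show ?thesis using eq finite_subset by blast
    next
      case False
      then show ?thesis using a b unfolding poly_rep_def by simp
    qed
  qed
qed

lemma poly_rep_poly_coeffs: "poly_rep n f (poly_coeffs n f)"
  unfolding poly_coeffs_def by (rule theI'[OF ex1_poly_rep])

end

theory Submission
  imports Defs
begin

text \<open>Identify a tuple with its support. An upper fan is given by a family \<open>\<A>\<close> of sets any two of which
  have the same union \<open>J = \<Union>\<A>\<close>, so the blocks \<open>J - A\<close> are pairwise disjoint. With \<open>C\<close> the rest of
  \<open>J\<close>, the fan equals \<open>min 0 (2 p + q - 2)\<close>, where \<open>p\<close> counts the zeros of \<open>x\<close> in \<open>C\<close> and \<open>q\<close> counts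
  the blocks containing a zero. Hence it is the minimum over one extra variable \<open>y\<close> of
  \<open>y (2 p + q - 2)\<close>. This is quadratic up to the monomials formed by \<open>y\<close> and a block, which have
  negative coefficient; one with a block of size at least 2 costs one more variable by
  \<open>- \<Prod>i\<in>I. x\<^sub>i = min\<^sub>w w (|I| - 1 - \<Sum>i\<in>I. x\<^sub>i)\<close>, and by disjointness there are at most \<open>|J| / 2\<close> such
  blocks. If \<open>|\<A>| \<ge> 3\<close>, the coefficient \<open>|\<A>| - 2\<close> of \<open>J\<close> is nonzero, so the degree is \<open>|J|\<close>.
  Lower fans reduce to upper ones by complementing all variables, which preserves the degree.\<close>

section \<open>Sums of binary submodular functions\<close>

text \<open>Every summand that occurs here is finite, so the calculations stay in the reals;
  \<open>ereal\<close> is left to this interface and to the final minimum.\<close>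

definition quad_sub :: "nat \<Rightarrow> (bool list \<Rightarrow> real) \<Rightarrow> bool" where
  "quad_sub N \<psi> \<longleftrightarrow> nonneg_combination Gamma_sub2 N (\<lambda>z. ereal (\<psi> z))"

lemma quad_sub_cong:
  assumes "quad_sub N \<psi>" "\<And>z. z \<in> tuples N \<Longrightarrow> \<psi>' z = \<psi> z"
  shows "quad_sub N \<psi>'"
  using assms unfolding quad_sub_def nonneg_combination_def by simp

lemma quad_sub_single:
  assumes "(k, f) \<in> Gamma_sub2" "length s = k" "set s \<subseteq> {..<N}"
    and "\<And>z. z \<in> tuples N \<Longrightarrow> ereal (\<psi> z) = f (map ((!) z) s)"
  shows "quad_sub N \<psi>"
  unfolding quad_sub_def nonneg_combination_def
  by (rule exI[of _ "[(1, (k, f), s)]"]) (use assms in \<open>simp add: one_ereal_def[symmetric]\<close>)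

lemma quad_sub_const: "quad_sub N (\<lambda>_. c)"
  by (rule quad_sub_single[of 0 "\<lambda>_. ereal c" "[]"])
    (auto simp: Gamma_sub2_def finite_valued_def submodular_def)

text \<open>The sign of \<open>c\<close> is free: on a two-element chain meet and join only permute
  the two arguments, so every unary function is modular.\<close>

lemma quad_sub_var:
  assumes "i < N"
  shows "quad_sub N (\<lambda>z. c * of_bool (z ! i))"
  by (rule quad_sub_single[of 1 "\<lambda>u. ereal (c * of_bool (u ! 0))" "[i]"])
    (use assms in \<open>auto simp: Gamma_sub2_def finite_valued_def submodular_def tuples_def
      meet_def join_def min_def max_def\<close>)

text \<open>The product of two variables is supermodular, hence the negative coefficient. The case
  \<open>i = j\<close> is included and gives a linear term.\<close>

lemma quad_sub_product:
  assumes "i < N" "j < N" "c \<ge> 0"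
  shows "quad_sub N (\<lambda>z. - c * of_bool (z ! i \<and> z ! j))"
proof (rule quad_sub_single[of 2 "\<lambda>u. ereal (- c * of_bool (u ! 0 \<and> u ! 1))" "[i, j]"])
  have "submodular 2 (\<lambda>u. ereal (- c * of_bool (u ! 0 \<and> u ! 1)))"
    unfolding submodular_def
  proof (intro ballI)
    fix u v
    assume "u \<in> tuples 2" "v \<in> tuples 2"
    then obtain a b c' d where "u = [a, b]" "v = [c', d]"
      by (auto simp: tuples_def numeral_2_eq_2 length_Suc_conv)
    then show "ereal (- c * of_bool (meet u v ! 0 \<and> meet u v ! 1))
        + ereal (- c * of_bool (join u v ! 0 \<and> join u v ! 1))
      \<le> ereal (- c * of_bool (u ! 0 \<and> u ! 1)) + ereal (- c * of_bool (v ! 0 \<and> v ! 1))"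
      using \<open>c \<ge> 0\<close> by (cases a; cases b; cases c'; cases d) (simp_all add: meet_def join_def)
  qed
  then show "(2, \<lambda>u. ereal (- c * of_bool (u ! 0 \<and> u ! 1))) \<in> Gamma_sub2"
    by (auto simp: Gamma_sub2_def finite_valued_def)
qed (use assms in \<open>auto\<close>)

lemma quad_sub_add:
  assumes "quad_sub N \<psi>1" "quad_sub N \<psi>2"
  shows "quad_sub N (\<lambda>z. \<psi>1 z + \<psi>2 z)"
proof -
  let ?ok = "\<lambda>(\<alpha>::real, (k, f), s). \<alpha> \<ge> 0 \<and> (k, f) \<in> Gamma_sub2 \<and> length s = k \<and> set s \<subseteq> {..<N}"
  let ?val = "\<lambda>z ts. \<Sum>(\<alpha>::real, (k::nat, f), s)\<leftarrow>ts. ereal \<alpha> * f (map (\<lambda>i. z ! i) s)"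
  obtain ts1 ts2
    where "\<forall>t\<in>set ts1. ?ok t" "\<forall>z\<in>tuples N. ereal (\<psi>1 z) = ?val z ts1"
      and "\<forall>t\<in>set ts2. ?ok t" "\<forall>z\<in>tuples N. ereal (\<psi>2 z) = ?val z ts2"
    using assms unfolding quad_sub_def nonneg_combination_def by blast
  then have "(\<forall>t\<in>set (ts1 @ ts2). ?ok t)
      \<and> (\<forall>z\<in>tuples N. ereal (\<psi>1 z + \<psi>2 z) = ?val z (ts1 @ ts2))"
    by (auto simp flip: plus_ereal.simps(1))
  then show ?thesis
    unfolding quad_sub_def nonneg_combination_def by blast
qed

lemma quad_sub_sum:
  assumes "finite S" "\<And>i. i \<in> S \<Longrightarrow> quad_sub N (\<psi> i)"
  shows "quad_sub N (\<lambda>z. \<Sum>i\<in>S. \<psi> i z)"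
  using assms by (induction S rule: finite_induct) (auto intro: quad_sub_const quad_sub_add)

section \<open>Closure under renaming and complementing variables\<close>

text \<open>Renaming acts on the scopes of the summands only. It serves to place functions with
  separate extra variables on one common list of variables.\<close>

lemma quad_sub_reindex:
  assumes "quad_sub N \<psi>" "\<And>i. i < N \<Longrightarrow> \<sigma> i < N'"
  shows "quad_sub N' (\<lambda>z. \<psi> (map (\<lambda>i. z ! \<sigma> i) [0..<N]))"
proof -
  let ?ok = "\<lambda>N (\<alpha>::real, (k, f), s). \<alpha> \<ge> 0 \<and> (k, f) \<in> Gamma_sub2 \<and> length s = k \<and> set s \<subseteq> {..<N}"
  let ?val = "\<lambda>z ts. \<Sum>(\<alpha>::real, (k::nat, f), s)\<leftarrow>ts. ereal \<alpha> * f (map (\<lambda>i. z ! i) s)"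
  let ?g = "\<lambda>(\<alpha>::real, (kf::cost_function), s). (\<alpha>, kf, map \<sigma> s)"
  obtain ts where ok: "\<forall>t\<in>set ts. ?ok N t" and val: "\<forall>z\<in>tuples N. ereal (\<psi> z) = ?val z ts"
    using assms unfolding quad_sub_def nonneg_combination_def by blast
  have "\<forall>t\<in>set (map ?g ts). ?ok N' t"
    using ok assms(2) by fastforce
  moreover have "ereal (\<psi> (map (\<lambda>i. z ! \<sigma> i) [0..<N])) = ?val z (map ?g ts)" for z
  proof -
    have "map ((!) (map (\<lambda>i. z ! \<sigma> i) [0..<N])) s = map ((!) z) (map \<sigma> s)" if "set s \<subseteq> {..<N}" for s
      using that by auto
    then have "?val (map (\<lambda>i. z ! \<sigma> i) [0..<N]) ts = ?val z (map ?g ts)"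
      unfolding map_map using ok by (intro arg_cong[where f = sum_list] map_cong) (auto simp del: map_eq_conv)
    then show ?thesis
      using val by (simp add: tuples_def)
  qed
  ultimately show ?thesis
    unfolding quad_sub_def nonneg_combination_def by blast
qed

lemma meet_join_map_Not:
  assumes "length u = length v"
  shows "map Not (meet u v) = join (map Not u) (map Not v)"
    and "map Not (join u v) = meet (map Not u) (map Not v)"
  using assms by (induction rule: list_induct2) (auto simp: meet_def join_def min_def max_def)

text \<open>By De Morgan, complementation exchanges meet and join, and the submodular inequality is
  symmetric in these two terms.\<close>

lemma Gamma_sub2_map_Not:
  assumes "(k, f) \<in> Gamma_sub2"
  shows "(k, f \<circ> map Not) \<in> Gamma_sub2"
  using assms unfolding Gamma_sub2_def finite_valued_def submodular_def tuples_def
  by (auto simp: meet_join_map_Not add.commute)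

lemma quad_sub_map_Not:
  assumes "quad_sub N \<psi>"
  shows "quad_sub N (\<lambda>z. \<psi> (map Not z))"
proof -
  let ?ok = "\<lambda>(\<alpha>::real, (k, f), s). \<alpha> \<ge> 0 \<and> (k, f) \<in> Gamma_sub2 \<and> length s = k \<and> set s \<subseteq> {..<N}"
  let ?val = "\<lambda>z ts. \<Sum>(\<alpha>::real, (k::nat, f), s)\<leftarrow>ts. ereal \<alpha> * f (map (\<lambda>i. z ! i) s)"
  let ?g = "\<lambda>(\<alpha>::real, (k::nat, f :: bool list \<Rightarrow> ereal), s::nat list). (\<alpha>, (k, f \<circ> map Not), s)"
  obtain ts where ok: "\<forall>t\<in>set ts. ?ok t" and val: "\<forall>z\<in>tuples N. ereal (\<psi> z) = ?val z ts"
    using assms unfolding quad_sub_def nonneg_combination_def by blast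
  have "\<forall>t\<in>set (map ?g ts). ?ok t"
    using ok Gamma_sub2_map_Not by fastforce
  moreover have "ereal (\<psi> (map Not z)) = ?val z (map ?g ts)" if z: "z \<in> tuples N" for z
  proof -
    have "map ((!) (map Not z)) s = map Not (map ((!) z) s)" if "set s \<subseteq> {..<N}" for s
      using that z by (auto simp: tuples_def)
    then have "?val (map Not z) ts = ?val z (map ?g ts)"
      unfolding map_map using ok by (intro arg_cong[where f = sum_list] map_cong) (auto simp: comp_def simp del: map_eq_conv)
    then show ?thesis
      using val z by (simp add: tuples_def)
  qed
  ultimately show ?thesis
    unfolding quad_sub_def nonneg_combination_def by blast
qed

section \<open>Partial minimisation\<close>

text \<open>Expressibility with \<open>j\<close> extra variables, the minimum being encoded as a
  lower bound that is attained. No constant \<kappa> appears, since \<open>quad_sub\<close> already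
  contains the constants.\<close>

definition quad_min :: "nat \<Rightarrow> nat \<Rightarrow> (bool list \<Rightarrow> real) \<Rightarrow> bool" where
  "quad_min n j \<phi> \<longleftrightarrow> (\<exists>\<psi>. quad_sub (n + j) \<psi> \<and>
     (\<forall>x\<in>tuples n. (\<forall>y\<in>tuples j. \<phi> x \<le> \<psi> (x @ y)) \<and> (\<exists>y\<in>tuples j. \<phi> x = \<psi> (x @ y))))"

lemma finite_tuples: "finite (tuples j)"
  using finite_lists_length_eq[of "UNIV :: bool set" j] by (simp add: tuples_def)

lemma expressible_with_if_quad_min:
  assumes "quad_min n j \<phi>"
  shows "expressible_with Gamma_sub2 j n (\<lambda>x. ereal (\<phi> x))"
proof -
  obtain \<psi> where \<psi>: "quad_sub (n + j) \<psi>"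
    "\<forall>x\<in>tuples n. (\<forall>y\<in>tuples j. \<phi> x \<le> \<psi> (x @ y)) \<and> (\<exists>y\<in>tuples j. \<phi> x = \<psi> (x @ y))"
    using assms unfolding quad_min_def by blast
  have "(MIN y\<in>tuples j. ereal (\<psi> (x @ y))) = ereal (\<phi> x)" if "x \<in> tuples n" for x
    using \<psi>(2) that by (intro Min_eqI) (auto simp: finite_tuples)
  then show ?thesis
    using \<psi>(1) unfolding expressible_with_def quad_sub_def
    \<comment> \<open>Any constant is already part of \<psi> as a function of arity 0, so \<kappa>
      is 0.\<close>
    by (intro exI[of _ "\<lambda>z. ereal (\<psi> z)"] exI[of _ 0]) simp
qed

lemma quad_min_cong:
  assumes "quad_min n j \<phi>" "\<And>x. x \<in> tuples n \<Longrightarrow> \<phi>' x = \<phi> x"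
  shows "quad_min n j \<phi>'"
  using assms unfolding quad_min_def by simp

lemma quad_min_0:
  assumes "quad_sub n \<phi>"
  shows "quad_min n 0 \<phi>"
  using assms unfolding quad_min_def by (intro exI[of _ \<phi>]) (simp add: tuples_def)

text \<open>The extra variables are complemented together with \<open>x\<close>; this permutes
  \<open>tuples j\<close>, so the minimum ranges over the same values.\<close>

lemma quad_min_map_Not:
  assumes "quad_min n j \<phi>"
  shows "quad_min n j (\<lambda>x. \<phi> (map Not x))"
proof -
  obtain \<psi> where \<psi>: "quad_sub (n + j) \<psi>"
    "\<And>x. x \<in> tuples n \<Longrightarrow> (\<forall>y\<in>tuples j. \<phi> x \<le> \<psi> (x @ y)) \<and> (\<exists>y\<in>tuples j. \<phi> x = \<psi> (x @ y))"
    using assms unfolding quad_min_def by blast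
  have "(\<forall>y\<in>tuples j. \<phi> (map Not x) \<le> \<psi> (map Not (x @ y)))
      \<and> (\<exists>y\<in>tuples j. \<phi> (map Not x) = \<psi> (map Not (x @ y)))" if x: "x \<in> tuples n" for x
  proof -
    have mem: "map Not y \<in> tuples k \<longleftrightarrow> y \<in> tuples k" for y k
      by (simp add: tuples_def)
    obtain y where y: "y \<in> tuples j" "\<phi> (map Not x) = \<psi> (map Not x @ y)"
      using \<psi>(2)[of "map Not x"] x mem by blast
    then have "\<phi> (map Not x) = \<psi> (map Not (x @ map Not y))"
      by (simp add: comp_def)
    then show ?thesis
      using \<psi>(2)[of "map Not x"] x y(1) mem by (metis map_append)
  qed
  then show ?thesis
    using quad_sub_map_Not[OF \<psi>(1)] unfolding quad_min_def by blast
qed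

text \<open>With separate blocks of extra variables for the two summands, the minimum of the sum is
  the sum of the minima.\<close>

lemma quad_min_add:
  assumes "quad_min n j1 \<phi>1" "quad_min n j2 \<phi>2"
  shows "quad_min n (j1 + j2) (\<lambda>x. \<phi>1 x + \<phi>2 x)"
proof -
  obtain \<psi>1 where \<psi>1: "quad_sub (n + j1) \<psi>1"
    "\<And>x. x \<in> tuples n \<Longrightarrow> (\<forall>y\<in>tuples j1. \<phi>1 x \<le> \<psi>1 (x @ y)) \<and> (\<exists>y\<in>tuples j1. \<phi>1 x = \<psi>1 (x @ y))"
    using assms unfolding quad_min_def by blast
  obtain \<psi>2 where \<psi>2: "quad_sub (n + j2) \<psi>2"
    "\<And>x. x \<in> tuples n \<Longrightarrow> (\<forall>y\<in>tuples j2. \<phi>2 x \<le> \<psi>2 (x @ y)) \<and> (\<exists>y\<in>tuples j2. \<phi>2 x = \<psi>2 (x @ y))"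
    using assms unfolding quad_min_def by blast
  \<comment> \<open>The variables are laid out as \<open>x @ y1 @ y2\<close>: the second summand
    keeps the first \<open>n\<close> positions and skips the \<open>j1\<close> positions of
    \<open>y1\<close>.\<close>
  define \<psi> where "\<psi> z = \<psi>1 (map (\<lambda>i. z ! i) [0..<n + j1])
      + \<psi>2 (map (\<lambda>i. z ! (if i < n then i else i + j1)) [0..<n + j2])" for z
  have "quad_sub (n + (j1 + j2)) \<psi>"
    unfolding \<psi>_def by (intro quad_sub_add quad_sub_reindex \<psi>1(1) \<psi>2(1)) auto
  moreover have eq: "\<psi> (x @ y1 @ y2) = \<psi>1 (x @ y1) + \<psi>2 (x @ y2)"
    if "x \<in> tuples n" "y1 \<in> tuples j1" "y2 \<in> tuples j2" for x y1 y2
  proof -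
    have "map (\<lambda>i. (x @ y1 @ y2) ! i) [0..<n + j1] = x @ y1"
      using that by (intro nth_equalityI) (auto simp: tuples_def nth_append)
    moreover have "map (\<lambda>i. (x @ y1 @ y2) ! (if i < n then i else i + j1)) [0..<n + j2] = x @ y2"
      using that by (intro nth_equalityI) (auto simp: tuples_def nth_append)
    ultimately show ?thesis
      unfolding \<psi>_def by simp
  qed
  moreover have "(\<forall>y\<in>tuples (j1 + j2). \<phi>1 x + \<phi>2 x \<le> \<psi> (x @ y))
      \<and> (\<exists>y\<in>tuples (j1 + j2). \<phi>1 x + \<phi>2 x = \<psi> (x @ y))" if x: "x \<in> tuples n" for x
  proof (intro conjI ballI)
    fix y
    assume "y \<in> tuples (j1 + j2)"
    then have "take j1 y \<in> tuples j1" "drop j1 y \<in> tuples j2"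
      by (auto simp: tuples_def)
    then show "\<phi>1 x + \<phi>2 x \<le> \<psi> (x @ y)"
      using eq[of x "take j1 y" "drop j1 y"] \<psi>1(2) \<psi>2(2) x by (auto intro: add_mono)
  next
    obtain y1 y2 where y: "y1 \<in> tuples j1" "\<phi>1 x = \<psi>1 (x @ y1)" "y2 \<in> tuples j2" "\<phi>2 x = \<psi>2 (x @ y2)"
      using \<psi>1(2) \<psi>2(2) x by blast
    then show "\<exists>y\<in>tuples (j1 + j2). \<phi>1 x + \<phi>2 x = \<psi> (x @ y)"
      using eq[of x y1 y2] x by (intro bexI[of _ "y1 @ y2"]) (auto simp: tuples_def)
  qed
  ultimately show ?thesis
    unfolding quad_min_def by blast
qed

lemma quad_min_sum:
  assumes "finite S" "\<And>i. i \<in> S \<Longrightarrow> quad_min n (j i) (\<phi> i)"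
  shows "quad_min n (\<Sum>i\<in>S. j i) (\<lambda>x. \<Sum>i\<in>S. \<phi> i x)"
  using assms
  by (induction S rule: finite_induct) (auto intro: quad_min_0 quad_sub_const quad_min_add)

text \<open>Nested minima merge: variable \<open>n\<close> of \<open>g\<close> becomes the first
  extra variable, ahead of the \<open>j\<close> that \<open>g\<close> already uses. Both the switch
  variable of a fan and the auxiliary variable of a monomial are introduced this way.\<close>

lemma quad_min_minimise:
  assumes g: "quad_min (n + 1) j g"
    and \<phi>: "\<And>x. x \<in> tuples n \<Longrightarrow> \<phi> x = min (g (x @ [False])) (g (x @ [True]))"
  shows "quad_min n (1 + j) \<phi>"
proof -
  obtain \<psi> where \<psi>: "quad_sub (n + 1 + j) \<psi>"
    "\<And>x. x \<in> tuples (n + 1) \<Longrightarrow> (\<forall>y\<in>tuples j. g x \<le> \<psi> (x @ y)) \<and> (\<exists>y\<in>tuples j. g x = \<psi> (x @ y))"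
    using g unfolding quad_min_def by blast
  have "(\<forall>y\<in>tuples (1 + j). \<phi> x \<le> \<psi> (x @ y)) \<and> (\<exists>y\<in>tuples (1 + j). \<phi> x = \<psi> (x @ y))"
    if x: "x \<in> tuples n" for x
  proof (intro conjI ballI)
    fix y
    assume "y \<in> tuples (1 + j)"
    then obtain b y' where y: "y = b # y'" "y' \<in> tuples j"
      by (auto simp: tuples_def length_Suc_conv)
    have "\<phi> x \<le> g (x @ [b])"
      using \<phi>[OF x] by (cases b) auto
    also have "\<dots> \<le> \<psi> ((x @ [b]) @ y')"
      using \<psi>(2)[of "x @ [b]"] x y by (auto simp: tuples_def)
    finally show "\<phi> x \<le> \<psi> (x @ y)"
      using y by simp
  next
    obtain b where b: "\<phi> x = g (x @ [b])"
      using \<phi>[OF x] by (metis min_def)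
    obtain y where "y \<in> tuples j" "g (x @ [b]) = \<psi> ((x @ [b]) @ y)"
      using \<psi>(2)[of "x @ [b]"] x by (auto simp: tuples_def)
    then show "\<exists>y\<in>tuples (1 + j). \<phi> x = \<psi> (x @ y)"
      using b by (intro bexI[of _ "b # y"]) (auto simp: tuples_def)
  qed
  then show ?thesis
    using \<psi>(1) unfolding quad_min_def by (auto simp: add.assoc)
qed

section \<open>Monomials\<close>

definition supp :: "bool list \<Rightarrow> nat set" where
  "supp x = {i. i < length x \<and> x ! i}"

definition monomial :: "nat set \<Rightarrow> bool list \<Rightarrow> real" where
  "monomial I z = of_bool (I \<subseteq> supp z)"

lemma quad_sub_monomial_small:
  assumes "I \<subseteq> {..<N}" "card I \<le> 2" "c \<ge> 0"
  shows "quad_sub N (\<lambda>z. - c * monomial I z)"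
proof -
  have "finite I"
    using assms(1) finite_subset by blast
  \<comment> \<open>The second case allows \<open>i = j\<close>, so that one product covers
    singletons and pairs.\<close>
  then consider "I = {}" | i j where "I = {i, j}"
    using assms(2) by (metis One_nat_def card_1_singletonE card_2_iff card_eq_0_iff insert_absorb2
        le_SucE le_zero_eq numeral_2_eq_2)
  then show ?thesis
  proof cases
    case 1
    then show ?thesis
      using quad_sub_const[of N "- c"] by (simp add: monomial_def)
  next
    case (2 i j)
    show ?thesis
      by (rule quad_sub_cong[OF quad_sub_product[of i N j c]])
        (use 2 assms in \<open>auto simp: monomial_def supp_def tuples_def\<close>)
  qed
qed

lemma insert_subset_supp_append:
  assumes "x \<in> tuples n" "I \<subseteq> {..<n}"
  shows "insert n I \<subseteq> supp (x @ [b]) \<longleftrightarrow> b \<and> I \<subseteq> supp x"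
  using assms by (auto simp: supp_def tuples_def nth_append subset_eq)

text \<open>When the extra variable is 1, the bracket \<open>|I| - 1 - (sum of x_i)\<close> is the
  number of zeros of \<open>x\<close> in \<open>I\<close> minus 1. This is -1 if there is no zero
  and nonnegative otherwise, so its minimum with 0 is minus the monomial.\<close>

lemma quad_min_monomial:
  assumes I: "I \<subseteq> {..<N}" and c: "c \<ge> 0"
  shows "quad_min N 1 (\<lambda>z. - c * monomial I z)"
proof -
  have fin: "finite I"
    using I finite_subset by blast
  \<comment> \<open>The extra variable has index \<open>N\<close>; multiplying it into the bracket
    leaves a linear term and products with nonpositive coefficients.\<close>
  define g where "g z = c * (real (card I) - 1) * of_bool (z ! N)
      + (\<Sum>i\<in>I. - c * of_bool (z ! i \<and> z ! N))" for z
  have "quad_sub (N + 1) g"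
    unfolding g_def using I c
    by (intro quad_sub_add quad_sub_var quad_sub_sum fin quad_sub_product) auto
  then have "quad_min (N + 1) 0 g"
    by (rule quad_min_0)
  moreover have "- c * monomial I x = min (g (x @ [False])) (g (x @ [True]))" if x: "x \<in> tuples N" for x
  proof -
    have "(\<Sum>i\<in>I. - c * of_bool ((x @ [True]) ! i)) = (\<Sum>i\<in>I. - c * of_bool (i \<in> supp x))"
      using x I by (intro sum.cong) (auto simp: supp_def tuples_def nth_append)
    also have "\<dots> = - c * real (card (I \<inter> supp x))"
      using fin by (simp add: sum_distrib_left[symmetric] sum_negf sum.If_cases of_bool_def)
    finally have "g (x @ [True]) = c * (real (card I) - 1 - real (card (I \<inter> supp x)))"
      using x by (simp add: g_def tuples_def nth_append algebra_simps)
    also have "\<dots> = c * (real (card (I - supp x)) - 1)"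
      using card_Int_Diff[OF fin, of "supp x"] by (simp add: algebra_simps)
    finally have T: "g (x @ [True]) = c * (real (card (I - supp x)) - 1)" .
    have F: "g (x @ [False]) = 0"
      using x by (simp add: g_def tuples_def nth_append)
    show ?thesis
    proof (cases "I \<subseteq> supp x")
      case True
      then show ?thesis
        using T F c by (simp add: monomial_def Diff_eq_empty_iff[THEN iffD2])
    next
      case False
      then have "card (I - supp x) \<ge> 1"
        using fin by (simp add: Suc_le_eq card_gt_0_iff)
      then show ?thesis
        using T F c False by (simp add: monomial_def)
    qed
  qed
  ultimately show ?thesis
    using quad_min_minimise by fastforce
qed

section \<open>Fans as set families\<close>

text \<open>The condition of \<open>upper_fan_set\<close> on supports; quantifying over ordered
  pairs covers both directions of incomparability. A point of the union missing from one member lies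
  in every other one, which makes the complements in the union disjoint.\<close>

definition fan_family :: "nat set set \<Rightarrow> bool" where
  "fan_family \<A> \<longleftrightarrow> (\<forall>A\<in>\<A>. \<forall>B\<in>\<A>. A \<noteq> B \<longrightarrow> \<not> A \<subseteq> B \<and> A \<union> B = \<Union>\<A>)"

definition fan_value :: "nat set set \<Rightarrow> nat set \<Rightarrow> real" where
  "fan_value \<A> X = (if \<Union>\<A> \<subseteq> X then -2 else if \<exists>A\<in>\<A>. A \<subseteq> X then -1 else 0)"

lemma supp_subset: "x \<in> tuples n \<Longrightarrow> supp x \<subseteq> {..<n}"
  by (auto simp: supp_def tuples_def)

lemma tuple_le_iff_supp:
  assumes "u \<in> tuples n" "v \<in> tuples n"
  shows "tuple_le u v \<longleftrightarrow> supp u \<subseteq> supp v"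
  using assms by (auto simp: tuple_le_def supp_def tuples_def list_all2_conv_all_nth)

lemma supp_join:
  assumes "u \<in> tuples n" "v \<in> tuples n"
  shows "supp (join u v) = supp u \<union> supp v"
  using assms by (auto simp: join_def supp_def tuples_def max_def)

lemma big_join_tuples: "big_join n F \<in> tuples n"
  by (simp add: big_join_def tuples_def)

lemma supp_big_join:
  assumes "F \<subseteq> tuples n"
  shows "supp (big_join n F) = \<Union>(supp ` F)"
proof -
  have "length a = n" if "a \<in> F" for a
    using assms that by (auto simp: tuples_def)
  then show ?thesis
    by (auto simp: big_join_def supp_def)
qed

lemma fan_family_supp:
  assumes "upper_fan_set n F"
  shows "fan_family (supp ` F)"
  unfolding fan_family_def
proof (intro ballI impI)
  fix A B
  assume "A \<in> supp ` F" "B \<in> supp ` F" "A \<noteq> B"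
  then obtain a b where ab: "a \<in> F" "b \<in> F" "A = supp a" "B = supp b" "a \<noteq> b"
    by blast
  moreover have F: "F \<subseteq> tuples n"
    using assms by (simp add: upper_fan_set_def)
  ultimately have "a \<in> tuples n" "b \<in> tuples n" "\<not> tuple_le a b" "join a b = big_join n F"
    using assms by (auto simp: upper_fan_set_def)
  then show "\<not> A \<subseteq> B \<and> A \<union> B = \<Union>(supp ` F)"
    using ab tuple_le_iff_supp supp_join supp_big_join[OF F] by metis
qed

lemma upper_fan_eq_fan_value:
  assumes "F \<subseteq> tuples n" "x \<in> tuples n"
  shows "upper_fan n F x = fan_value (supp ` F) (supp x)"
proof -
  have "(\<exists>a\<in>F. tuple_le a x) \<longleftrightarrow> (\<exists>A\<in>supp ` F. A \<subseteq> supp x)"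
    using assms tuple_le_iff_supp[OF _ assms(2)] by (simp add: subset_eq)
  moreover have "tuple_le (big_join n F) x \<longleftrightarrow> \<Union>(supp ` F) \<subseteq> supp x"
    using tuple_le_iff_supp[OF big_join_tuples assms(2)] supp_big_join[OF assms(1)] by simp
  ultimately show ?thesis
    by (simp only: upper_fan_def fan_value_def)
qed

section \<open>Expressing a fan\<close>

text \<open>\<open>C\<close> consists of the points common to all members, where a zero excludes
  every member from \<open>X\<close>. A zero in the block of \<open>A\<close> excludes
  \<open>A\<close> alone among the conditions on blocks, but lies in all other members. So the value
  is -1 exactly when one block and nothing else in the union contains zeros.\<close>

lemma fan_value_eq_min:
  fixes \<A> :: "nat set set" and X :: "nat set"
  defines "C \<equiv> \<Union>\<A> - (\<Union>A\<in>\<A>. \<Union>\<A> - A)"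
  assumes fan: "fan_family \<A>" and fin: "finite \<A>" "finite (\<Union>\<A>)"
  shows "fan_value \<A> X = min 0 (2 * real (card (C - X)) + real (card {A\<in>\<A>. \<not> \<Union>\<A> - A \<subseteq> X}) - 2)"
proof -
  define N where "N = {A\<in>\<A>. \<not> \<Union>\<A> - A \<subseteq> X}"
  have finN: "finite N" and finC: "finite (C - X)"
    using fin by (auto simp: N_def C_def)
  consider (top) "\<Union>\<A> \<subseteq> X" | (middle) A where "\<not> \<Union>\<A> \<subseteq> X" "A \<in> \<A>" "A \<subseteq> X"
    | (bottom) "\<not> \<Union>\<A> \<subseteq> X" "\<forall>A\<in>\<A>. \<not> A \<subseteq> X"
    by blast
  then have "fan_value \<A> X = min 0 (2 * real (card (C - X)) + real (card N) - 2)"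
  proof cases
    case top
    then have "C - X = {}" "N = {}"
      by (auto simp: C_def N_def)
    then show ?thesis
      using top by (simp only: fan_value_def card.empty) simp
  next
    case (middle A)
    have "C - X = {}"
      using middle by (auto simp: C_def)
    moreover have "N = {A}"
    proof -
      \<comment> \<open>Since \<open>A\<close> and \<open>B\<close> cover the union, the block of
        \<open>B\<close> lies inside \<open>A\<close>, hence inside \<open>X\<close>.\<close>
      have "\<Union>\<A> - B \<subseteq> X" if "B \<in> \<A>" "B \<noteq> A" for B
        using fan that middle unfolding fan_family_def by blast
      then show ?thesis
        using middle by (auto simp: N_def)
    qed
    moreover have "\<exists>A\<in>\<A>. A \<subseteq> X"
      using middle by blast
    then have "fan_value \<A> X = -1"
      by (simp only: fan_value_def middle(1) if_True if_False)
    ultimately show ?thesis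
      by (simp only: card.empty) simp
  next
    case bottom
    \<comment> \<open>A zero in \<open>C\<close> counts 2 by itself; without one, two distinct
      blocks must contain zeros.\<close>
    have "2 * card (C - X) + card N \<ge> 2"
    proof (cases "C \<subseteq> X")
      case True
      \<comment> \<open>The zero \<open>k\<close> lies in the block of some \<open>A\<close>. As
        \<open>A\<close> is not inside \<open>X\<close> either, it contains a zero \<open>i\<close>,
        which lies in the block of another member \<open>B\<close>.\<close>
      obtain k where k: "k \<in> \<Union>\<A>" "k \<notin> X"
        using bottom by blast
      then obtain A where "A \<in> \<A>" "k \<notin> A"
        using True by (auto simp: C_def)
      then have A: "A \<in> N"
        using k by (auto simp: N_def)
      then obtain i where i: "i \<in> A" "i \<notin> X" "A \<in> \<A>"
        using bottom by (auto simp: N_def)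
      then obtain B where "B \<in> \<A>" "i \<notin> B"
        using True by (auto simp: C_def)
      then have B: "B \<in> N" "A \<noteq> B"
        using i by (auto simp: N_def)
      then have "card {A, B} \<le> card N"
        using A finN by (intro card_mono) auto
      then show ?thesis
        using B by simp
    next
      case False
      then have "card (C - X) > 0"
        using finC by (auto simp: card_gt_0_iff)
      then show ?thesis by simp
    qed
    then show ?thesis
      using bottom by (auto simp: fan_value_def)
  qed
  then show ?thesis
    by (simp add: N_def)
qed

text \<open>The leading 1 pays for the variable that switches between 0 and the expression of
  \<open>fan_value_eq_min\<close>. A block of at least two elements, multiplied by this variable,
  gives degree at least 3 and costs one more.\<close>

lemma quad_min_fan:
  assumes sub: "\<A> \<subseteq> Pow {..<n}" and fan: "fan_family \<A>"
  shows "quad_min n (1 + (\<Sum>A\<in>\<A>. of_bool (card (\<Union>\<A> - A) \<ge> 2))) (\<lambda>x. fan_value \<A> (supp x))"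
proof -
  define J where "J = \<Union>\<A>"
  define C where "C = J - (\<Union>A\<in>\<A>. J - A)"
  have J: "J \<subseteq> {..<n}" and C: "C \<subseteq> J"
    using sub by (auto simp: J_def C_def)
  have fin: "finite \<A>" "finite J" "finite C"
    using finite_subset[OF sub] finite_subset[OF J] finite_subset[OF C] by auto
  \<comment> \<open>Variable \<open>n\<close> is the switch. Zeros are counted as
    \<open>card C\<close> minus the sum over \<open>C\<close> of the variables, and as
    \<open>card \<A>\<close> minus the sum of the block monomials; the two cardinalities go into the
    linear coefficient.\<close>
  define g where "g z = (real (card \<A>) - 2 + 2 * real (card C)) * of_bool (z ! n)
    + (\<Sum>i\<in>C. - 2 * monomial {n, i} z) + (\<Sum>A\<in>\<A>. - 1 * monomial (insert n (J - A)) z)" for z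
  have block: "quad_min (n + 1) (of_bool (card (J - A) \<ge> 2)) (\<lambda>z. - 1 * monomial (insert n (J - A)) z)"
    for A
  proof (cases "card (J - A) \<ge> 2")
    case True
    then show ?thesis
      using quad_min_monomial[of "insert n (J - A)" "n + 1" 1] J by fastforce
  next
    case False
    then have "card (insert n (J - A)) \<le> 2"
      using fin(2) by (simp add: card_insert_if)
    moreover have "insert n (J - A) \<subseteq> {..<n + 1}"
      using J by auto
    ultimately show ?thesis
      using False quad_min_0[OF quad_sub_monomial_small[of "insert n (J - A)" "n + 1" 1]] by simp
  qed
  have "quad_min (n + 1) (0 + (\<Sum>A\<in>\<A>. of_bool (card (J - A) \<ge> 2))) g"
    unfolding g_def
  proof (rule quad_min_add)
    show "quad_min (n + 1) 0 (\<lambda>z. (real (card \<A>) - 2 + 2 * real (card C)) * of_bool (z ! n)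
        + (\<Sum>i\<in>C. - 2 * monomial {n, i} z))"
      using C J by (intro quad_min_0 quad_sub_add quad_sub_var quad_sub_sum quad_sub_monomial_small fin)
        (auto simp: card_insert_if)
    show "quad_min (n + 1) (\<Sum>A\<in>\<A>. of_bool (card (J - A) \<ge> 2))
        (\<lambda>z. \<Sum>A\<in>\<A>. - 1 * monomial (insert n (J - A)) z)"
      by (rule quad_min_sum[OF fin(1) block])
  qed
  moreover have "fan_value \<A> (supp x) = min (g (x @ [False])) (g (x @ [True]))" if x: "x \<in> tuples n" for x
  proof -
    have mon: "monomial (insert n I) (x @ [b]) = of_bool (b \<and> I \<subseteq> supp x)" if "I \<subseteq> J" for I b
      using insert_subset_supp_append[OF x] that J by (auto simp: monomial_def)
    have c: "(\<Sum>i\<in>C. - 2 * monomial {n, i} (x @ [b])) = (\<Sum>i\<in>C. - 2 * of_bool (b \<and> i \<in> supp x))" for b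
      using mon C by (intro sum.cong) auto
    have a: "(\<Sum>A\<in>\<A>. - 1 * monomial (insert n (J - A)) (x @ [b]))
        = (\<Sum>A\<in>\<A>. - 1 * of_bool (b \<and> J - A \<subseteq> supp x))" for b
      using mon by (intro sum.cong) auto
    have F: "g (x @ [False]) = 0"
      using x unfolding g_def c a by (simp add: tuples_def nth_append)
    have "(\<Sum>i\<in>C. - 2 * of_bool (i \<in> supp x)) = - 2 * real (card (C \<inter> supp x))"
      using fin by (simp add: sum_distrib_left[symmetric] sum_negf sum.If_cases of_bool_def)
    moreover have "(\<Sum>A\<in>\<A>. - 1 * of_bool (J - A \<subseteq> supp x)) = - real (card {A\<in>\<A>. J - A \<subseteq> supp x})"
      using fin by (simp add: sum_negf sum.If_cases of_bool_def Int_def)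
    moreover have "card C = card (C \<inter> supp x) + card (C - supp x)"
      using card_Int_Diff[OF fin(3)] .
    moreover have "card \<A> = card {A\<in>\<A>. J - A \<subseteq> supp x} + card {A\<in>\<A>. \<not> J - A \<subseteq> supp x}"
      using fin(1) by (subst card_Un_disjoint[symmetric]) (auto intro!: arg_cong[where f = card])
    ultimately have "g (x @ [True])
        = 2 * real (card (C - supp x)) + real (card {A\<in>\<A>. \<not> J - A \<subseteq> supp x}) - 2"
      using x unfolding g_def c a by (simp add: tuples_def nth_append)
    then show ?thesis
      using fan_value_eq_min[OF fan fin(1), of "supp x"] fin(2) F unfolding J_def C_def by simp
  qed
  ultimately show ?thesis
    using quad_min_minimise[of n _ g] unfolding J_def by simp
qed

section \<open>The multilinear form of a fan\<close>

text \<open>Two distinct members inside \<open>X\<close> would put the whole union there, so below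
  the top value at most one member monomial is 1. At the top all of them are 1, and the extra term
  corrects their sum to -2.\<close>

lemma fan_value_eq_monomials:
  assumes fan: "fan_family \<A>" and fin: "finite \<A>" and two: "card \<A> \<ge> 2"
  shows "fan_value \<A> X = (real (card \<A>) - 2) * of_bool (\<Union>\<A> \<subseteq> X) - real (card {A\<in>\<A>. A \<subseteq> X})"
proof -
  consider (top) "\<Union>\<A> \<subseteq> X" | (middle) A where "\<not> \<Union>\<A> \<subseteq> X" "A \<in> \<A>" "A \<subseteq> X"
    | (bottom) "\<not> \<Union>\<A> \<subseteq> X" "\<forall>A\<in>\<A>. \<not> A \<subseteq> X"
    by blast
  then show ?thesis
  proof cases
    case top
    then have "{A\<in>\<A>. A \<subseteq> X} = \<A>" by auto
    then show ?thesis
      using top by (simp only: fan_value_def) simp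
  next
    case (middle A)
    have "B = A" if "B \<in> \<A>" "B \<subseteq> X" for B
    proof (rule ccontr)
      assume "B \<noteq> A"
      then have "\<Union>\<A> = B \<union> A"
        using fan that middle unfolding fan_family_def by blast
      then show False
        using that middle by simp
    qed
    then have "{A\<in>\<A>. A \<subseteq> X} = {A}"
      using middle by blast
    moreover have "\<exists>A\<in>\<A>. A \<subseteq> X"
      using middle by blast
    then have "fan_value \<A> X = -1"
      by (simp only: fan_value_def middle(1) if_True if_False)
    ultimately show ?thesis
      using middle(1) by (simp only:) simp
  next
    case bottom
    then have "{A\<in>\<A>. A \<subseteq> X} = {}" by auto
    then show ?thesis
      using bottom by (simp only: fan_value_def) auto
  qed
qed

section \<open>The degree of a fan\<close>

lemma poly_coeffs_eqI: "poly_rep n f a \<Longrightarrow> poly_coeffs n f = a"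
  using ex1_poly_rep poly_rep_poly_coeffs by blast

lemma poly_degree_ge:
  assumes "I \<subseteq> {..<n}" "poly_coeffs n f I \<noteq> 0"
  shows "card I \<le> poly_degree n f"
  unfolding poly_degree_def using assms
  by (intro Max_ge) (auto intro!: finite_imageI finite_subset[of _ "Pow {..<n}"])

lemma poly_degree_leI:
  assumes "\<And>I. I \<subseteq> {..<n} \<Longrightarrow> poly_coeffs n f I \<noteq> 0 \<Longrightarrow> card I \<le> d"
  shows "poly_degree n f \<le> d"
  unfolding poly_degree_def using assms
  by (intro Max.boundedI) (auto intro!: finite_imageI finite_subset[of _ "Pow {..<n}"])

text \<open>\<open>fan_value_eq_monomials\<close> is already multilinear, so uniqueness of the
  representation lets its coefficients be read off.\<close>

lemma fan_poly_coeffs: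
  assumes sub: "\<A> \<subseteq> Pow {..<n}" and fan: "fan_family \<A>" and two: "card \<A> \<ge> 2"
    and \<phi>: "\<And>x. x \<in> tuples n \<Longrightarrow> \<phi> x = fan_value \<A> (supp x)"
  shows "poly_coeffs n \<phi> = (\<lambda>I. (real (card \<A>) - 2) * of_bool (I = \<Union>\<A>) - of_bool (I \<in> \<A>))"
proof (rule poly_coeffs_eqI, unfold poly_rep_iff, intro conjI allI impI)
  fix I
  assume I: "\<not> I \<subseteq> {..<n}"
  then have "I \<noteq> \<Union>\<A>" "I \<notin> \<A>"
    using sub by auto
  then show "(real (card \<A>) - 2) * of_bool (I = \<Union>\<A>) - of_bool (I \<in> \<A>) = 0"
    by simp
next
  fix X
  assume X: "X \<subseteq> {..<n}"
  then have finX: "finite (Pow X)"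
    using finite_subset by blast
  have "supp (map (\<lambda>i. i \<in> X) [0..<n]) = X"
    using X by (auto simp: supp_def)
  then have "\<phi> (map (\<lambda>i. i \<in> X) [0..<n]) = fan_value \<A> X"
    using \<phi>[of "map (\<lambda>i. i \<in> X) [0..<n]"] by (simp add: tuples_def)
  also have "\<dots> = (real (card \<A>) - 2) * of_bool (\<Union>\<A> \<subseteq> X) - real (card {A\<in>\<A>. A \<subseteq> X})"
    \<comment> \<open>An infinite set has \<open>card\<close> 0, so \<open>two\<close> yields the
      finiteness of \<A>.\<close>
    using fan_value_eq_monomials[OF fan _ two] two card.infinite by fastforce
  also have "real (card {A\<in>\<A>. A \<subseteq> X}) = (\<Sum>I\<in>Pow X. of_bool (I \<in> \<A>))"
    using finX by (simp add: of_bool_def sum.If_cases Int_def conj_commute)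
  also have "(real (card \<A>) - 2) * of_bool (\<Union>\<A> \<subseteq> X)
      = (\<Sum>I\<in>Pow X. (real (card \<A>) - 2) * of_bool (I = \<Union>\<A>))"
    using finX by (simp add: of_bool_def flip: sum_distrib_left)
  finally show "\<phi> (map (\<lambda>i. i \<in> X) [0..<n])
      = (\<Sum>I\<in>Pow X. (real (card \<A>) - 2) * of_bool (I = \<Union>\<A>) - of_bool (I \<in> \<A>))"
    by (simp add: sum_subtractf)
qed

text \<open>The blocks are disjoint subsets of the union, and each one counted has at least two
  elements.\<close>

lemma blocks_bound:
  assumes fan: "fan_family \<A>" and fin: "finite \<A>" "finite (\<Union>\<A>)"
  shows "2 * (\<Sum>A\<in>\<A>. of_bool (card (\<Union>\<A> - A) \<ge> 2)) \<le> card (\<Union>\<A>)"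
proof -
  have "2 * (\<Sum>A\<in>\<A>. of_bool (card (\<Union>\<A> - A) \<ge> 2)) \<le> (\<Sum>A\<in>\<A>. card (\<Union>\<A> - A))"
    unfolding sum_distrib_left by (intro sum_mono) auto
  also have "\<dots> = card (\<Union>A\<in>\<A>. \<Union>\<A> - A)"
    using fan fin unfolding fan_family_def by (intro card_UN_disjoint[symmetric]) auto
  also have "\<dots> \<le> card (\<Union>\<A>)"
    using fin by (intro card_mono) auto
  finally show ?thesis .
qed

text \<open>Two members need a separate treatment: then the coefficient of \<open>\<Union>\<A>\<close> vanishes, so the
  degree is only the size of the larger member.\<close>

lemma quad_min_fan_degree:
  assumes sub: "\<A> \<subseteq> Pow {..<n}" and fan: "fan_family \<A>"
    and \<phi>: "\<And>x. x \<in> tuples n \<Longrightarrow> \<phi> x = fan_value \<A> (supp x)"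
  shows "\<exists>j \<le> 1 + poly_degree n \<phi> div 2. quad_min n j \<phi>"
proof -
  let ?blocks = "\<Sum>A\<in>\<A>. of_bool (card (\<Union>\<A> - A) \<ge> 2) :: nat"
  have J: "\<Union>\<A> \<subseteq> {..<n}"
    using sub by auto
  have fin: "finite \<A>" "finite (\<Union>\<A>)"
    using finite_subset[OF sub] finite_subset[OF J] by auto
  have general: "quad_min n (1 + ?blocks) \<phi>"
    by (rule quad_min_cong[OF quad_min_fan[OF sub fan] \<phi>])
  consider "card \<A> \<le> 1" | "card \<A> = 2" | "card \<A> \<ge> 3"
    by linarith
  then show ?thesis
  proof cases
    case 1
    \<comment> \<open>A sole member equals the union, so there is no nonempty block and the switch
      variable suffices.\<close>
    then have "\<Union>\<A> - A = {}" if "A \<in> \<A>" for A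
      using that fin card_le_Suc0_iff_eq[of \<A>] by auto
    then have "\<not> card (\<Union>\<A> - A) \<ge> 2" if "A \<in> \<A>" for A
      using that by (metis card.empty not_numeral_le_zero)
    then have "?blocks = 0" by simp
    then show ?thesis
      using general by (intro exI[of _ 1]) simp
  next
    case 2
    \<comment> \<open>The factor \<open>card \<A> - 2\<close> is 0, which leaves coefficient -1 on
      each member.\<close>
    then have coeff: "poly_coeffs n \<phi> A \<noteq> 0" if "A \<in> \<A>" for A
      using fan_poly_coeffs[OF sub fan _ \<phi>] that by simp
    have deg: "card A \<le> poly_degree n \<phi>" if "A \<in> \<A>" for A
      using that sub coeff by (intro poly_degree_ge) auto
    show ?thesis
    proof (cases "poly_degree n \<phi> \<ge> 2")
      case True
      \<comment> \<open>Degree at least 2 allows two extra variables. Here \<phi> is minus the sum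
        of the two member monomials, so each gets one and no switch is used.\<close>
      have "quad_min n (\<Sum>A\<in>\<A>. 1) (\<lambda>x. \<Sum>A\<in>\<A>. - 1 * monomial A x)"
        using sub by (intro quad_min_sum fin quad_min_monomial) auto
      moreover have "\<phi> x = (\<Sum>A\<in>\<A>. - 1 * monomial A x)" if "x \<in> tuples n" for x
        using 2 fin \<phi>[OF that] fan_value_eq_monomials[OF fan]
        by (simp add: monomial_def sum_negf of_bool_def sum.If_cases Int_def)
      ultimately have "quad_min n 2 \<phi>"
        using 2 quad_min_cong by fastforce
      then show ?thesis
        using True by (intro exI[of _ 2]) auto
    next
      case False
      \<comment> \<open>Each block is contained in the other member, which has at most one element
        by the degree; so no block costs a variable.\<close>
      have "card (\<Union>\<A> - A) \<le> 1" if "A \<in> \<A>" for A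
      proof -
        obtain B where B: "B \<in> \<A>" "B \<noteq> A"
          using 2 by (metis card_2_iff')
        then have "\<Union>\<A> - A \<subseteq> B"
          using fan that unfolding fan_family_def by blast
        then have "card (\<Union>\<A> - A) \<le> card B"
          using B fin by (intro card_mono) (auto intro: finite_subset)
        then show ?thesis
          using deg[OF B(1)] False by simp
      qed
      then have "?blocks = 0" by (intro sum.neutral) fastforce
      then show ?thesis
        using general by (intro exI[of _ 1]) simp
    qed
  next
    case 3
    \<comment> \<open>Otherwise every other member would be comparable to it. So no member term
      interferes with the coefficient \<open>card \<A> - 2\<close>, which is positive.\<close>
    have "\<Union>\<A> \<notin> \<A>"
    proof
      assume top: "\<Union>\<A> \<in> \<A>"
      have "\<not> \<A> \<subseteq> {\<Union>\<A>}"
        using 3 card_mono[of "{\<Union>\<A>}" \<A>] by force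
      then show False
        using fan top unfolding fan_family_def by blast
    qed
    then have "poly_coeffs n \<phi> (\<Union>\<A>) \<noteq> 0"
      using 3 fan_poly_coeffs[OF sub fan _ \<phi>] by simp
    then have "card (\<Union>\<A>) \<le> poly_degree n \<phi>"
      using J by (intro poly_degree_ge)
    then have "?blocks \<le> poly_degree n \<phi> div 2"
      using blocks_bound[OF fan fin] by linarith
    then show ?thesis
      using general by (intro exI[of _ "1 + ?blocks"]) simp
  qed
qed

section \<open>Duality\<close>

text \<open>Expanding the product of \<open>1 - x_i\<close> over \<open>I\<close> yields only
  monomials on subsets of \<open>I\<close>, so every new monomial lies below an old one with nonzero
  coefficient.\<close>

lemma poly_degree_map_Not_le: "poly_degree n (\<lambda>x. f (map Not x)) \<le> poly_degree n f"
proof (rule poly_degree_leI)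
  define a where "a = poly_coeffs n f"
  have rep: "poly_rep n f a"
    unfolding a_def by (rule poly_rep_poly_coeffs)
  \<comment> \<open>The monomial on \<open>K\<close> receives a contribution from each
    \<open>I\<close> containing \<open>K\<close>, always with sign
    \<open>(-1) ^ card K\<close>.\<close>
  define b where "b K = (if K \<subseteq> {..<n} then (-1) ^ card K * (\<Sum>I | K \<subseteq> I \<and> I \<subseteq> {..<n}. a I) else 0)"
    for K
  have "poly_rep n (\<lambda>x. f (map Not x)) b"
    unfolding poly_rep_def
  proof (intro conjI ballI allI impI)
    fix x
    assume x: "x \<in> tuples n"
    let ?p = "\<lambda>K. \<Prod>i\<in>K. of_bool (x ! i) :: real"
    have expand: "(\<Prod>i\<in>I. of_bool (map Not x ! i)) = (\<Sum>K\<in>Pow I. (-1) ^ card K * ?p K)"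
      if I: "I \<subseteq> {..<n}" for I
    proof -
      have "finite I"
        using I finite_subset by blast
      have "(\<Prod>i\<in>I. of_bool (map Not x ! i)) = (\<Prod>i\<in>I. - of_bool (x ! i) + (1::real))"
        using I x by (intro prod.cong) (auto simp: tuples_def of_bool_def subset_eq)
      also have "\<dots> = (\<Sum>K\<in>Pow I. (\<Prod>i\<in>K. - of_bool (x ! i)) * (\<Prod>i\<in>I - K. 1))"
        by (rule prod_add[OF \<open>finite I\<close>])
      finally show ?thesis
        by (simp add: prod_uminus)
    qed
    have "f (map Not x) = (\<Sum>I\<in>Pow {..<n}. a I * (\<Prod>i\<in>I. of_bool (map Not x ! i)))"
      using rep x by (simp add: poly_rep_def tuples_def)
    also have "\<dots> = (\<Sum>I\<in>Pow {..<n}. \<Sum>K\<in>Pow I. a I * ((-1) ^ card K * ?p K))"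
      using expand by (intro sum.cong) (auto simp: sum_distrib_left)
    \<comment> \<open>Both indices now range over \<open>Pow {..<n}\<close> under the relation
      \<open>K \<subseteq> I\<close>, so the order of summation can be exchanged.\<close>
    also have "\<dots> = (\<Sum>I\<in>Pow {..<n}. \<Sum>K | K \<in> Pow {..<n} \<and> K \<subseteq> I. a I * ((-1) ^ card K * ?p K))"
      by (intro sum.cong) auto
    also have "\<dots> = (\<Sum>K\<in>Pow {..<n}. \<Sum>I | I \<in> Pow {..<n} \<and> K \<subseteq> I. a I * ((-1) ^ card K * ?p K))"
      by (rule sum.swap_restrict) auto
    also have "\<dots> = (\<Sum>K\<in>Pow {..<n}. b K * ?p K)"
      by (intro sum.cong) (auto simp: b_def sum_distrib_left sum_distrib_right conj_commute mult_ac)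
    finally show "f (map Not x) = (\<Sum>K\<in>Pow {..<n}. b K * ?p K)" .
  qed (simp add: b_def)
  then have coeffs: "poly_coeffs n (\<lambda>x. f (map Not x)) = b"
    by (rule poly_coeffs_eqI)
  fix K
  assume K: "K \<subseteq> {..<n}" "poly_coeffs n (\<lambda>x. f (map Not x)) K \<noteq> 0"
  then have "(\<Sum>I | K \<subseteq> I \<and> I \<subseteq> {..<n}. a I) \<noteq> 0"
    by (simp add: coeffs b_def)
  then obtain I where I: "K \<subseteq> I" "I \<subseteq> {..<n}" "a I \<noteq> 0"
    using sum.not_neutral_contains_not_neutral by force
  then have "card K \<le> card I"
    using finite_subset by (intro card_mono) auto
  also have "\<dots> \<le> poly_degree n f"
    using I by (intro poly_degree_ge) (auto simp: a_def)
  finally show "card K \<le> poly_degree n f" .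
qed

lemma tuple_le_map_Not: "tuple_le (map Not u) (map Not v) \<longleftrightarrow> tuple_le v u"
  by (auto simp: tuple_le_def list_all2_conv_all_nth)

lemma map_Not_big_meet:
  assumes "G \<subseteq> tuples n"
  shows "map Not (big_meet n G) = big_join n (map Not ` G)"
proof -
  have "length a = n" if "a \<in> G" for a
    using assms that by (auto simp: tuples_def)
  then show ?thesis
    by (auto simp: big_meet_def big_join_def)
qed

lemma upper_fan_set_map_Not:
  assumes "lower_fan_set n G"
  shows "upper_fan_set n (map Not ` G)"
proof -
  have G: "G \<subseteq> tuples n"
    using assms by (simp add: lower_fan_set_def)
  show ?thesis
    unfolding upper_fan_set_def
  proof (intro conjI ballI impI)
    show "map Not ` G \<subseteq> tuples n"
      using G by (auto simp: tuples_def)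
    fix a' b'
    assume "a' \<in> map Not ` G" "b' \<in> map Not ` G" "a' \<noteq> b'"
    then obtain a b where ab: "a \<in> G" "b \<in> G" "a' = map Not a" "b' = map Not b" "a \<noteq> b"
      by blast
    then have *: "\<not> tuple_le a b" "\<not> tuple_le b a" "meet a b = big_meet n G" "length a = length b"
      using assms G by (auto simp: lower_fan_set_def tuples_def)
    show "\<not> tuple_le a' b'" "\<not> tuple_le b' a'"
      using * ab by (auto simp: tuple_le_map_Not)
    show "join a' b' = big_join n (map Not ` G)"
      using * ab by (metis meet_join_map_Not(1) map_Not_big_meet[OF G])
  qed
qed

lemma upper_fan_map_Not:
  assumes "G \<subseteq> tuples n"
  shows "upper_fan n (map Not ` G) (map Not x) = lower_fan n G x"
  unfolding upper_fan_def lower_fan_def map_Not_big_meet[OF assms, symmetric]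
  by (simp add: tuple_le_map_Not)

lemma quad_min_upper_fan:
  assumes "upper_fan_set n F" "\<And>x. x \<in> tuples n \<Longrightarrow> \<phi> x = upper_fan n F x"
  shows "\<exists>j \<le> 1 + poly_degree n \<phi> div 2. quad_min n j \<phi>"
proof -
  have F: "F \<subseteq> tuples n"
    using assms(1) by (simp add: upper_fan_set_def)
  show ?thesis
  proof (rule quad_min_fan_degree)
    show "supp ` F \<subseteq> Pow {..<n}"
      using F supp_subset by blast
    show "fan_family (supp ` F)"
      by (rule fan_family_supp[OF assms(1)])
    show "\<phi> x = fan_value (supp ` F) (supp x)" if "x \<in> tuples n" for x
      using assms(2) upper_fan_eq_fan_value[OF F] that by simp
  qed
qed

text \<open>The complemented function is an upper fan whose degree is at most that of \<phi>;
  complementing its expression back keeps the number of extra variables.\<close>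

lemma quad_min_lower_fan:
  assumes "lower_fan_set n G" "\<And>x. x \<in> tuples n \<Longrightarrow> \<phi> x = lower_fan n G x"
  shows "\<exists>j \<le> 1 + poly_degree n \<phi> div 2. quad_min n j \<phi>"
proof -
  have G: "G \<subseteq> tuples n"
    using assms(1) by (simp add: lower_fan_set_def)
  have "\<phi> (map Not x) = upper_fan n (map Not ` G) x" if "x \<in> tuples n" for x
    using assms(2)[of "map Not x"] upper_fan_map_Not[OF G, of "map Not x"] that
    by (simp add: tuples_def comp_def)
  then obtain j where j: "j \<le> 1 + poly_degree n (\<lambda>x. \<phi> (map Not x)) div 2"
    "quad_min n j (\<lambda>x. \<phi> (map Not x))"
    using quad_min_upper_fan[OF upper_fan_set_map_Not[OF assms(1)], of "\<lambda>x. \<phi> (map Not x)"] by blast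
  have "quad_min n j \<phi>"
    using quad_min_map_Not[OF j(2)] by (simp add: comp_def)
  moreover have "j \<le> 1 + poly_degree n \<phi> div 2"
    using j(1) div_le_mono[OF poly_degree_map_Not_le[of n \<phi>], of 2] by linarith
  ultimately show ?thesis
    by blast
qed

theorem theorem1:
  fixes n :: nat and \<phi> :: "bool list \<Rightarrow> real"
  assumes "n \<ge> 1" and "is_fan n \<phi>"
  shows "\<exists>j \<le> 1 + poly_degree n \<phi> div 2.
           expressible_with Gamma_sub2 j n (\<lambda>x. ereal (\<phi> x))"
proof -
  have "\<exists>j \<le> 1 + poly_degree n \<phi> div 2. quad_min n j \<phi>"
    using assms(2) quad_min_upper_fan quad_min_lower_fan unfolding is_fan_def by blast
  then show ?thesis
    using expressible_with_if_quad_min by blast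
qed

end
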